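(* (a) Let $\mathfrak{q}$ be a Leibniz algebra over $\mathbb{K}$ and let $0=\mathfrak{m}_0\trianglelefteq\mathfrak{m}_1\trianglelefteq\dots\trianglelefteq\mathfrak{m}_{j-1}\trianglelefteq\mathfrak{m}_j=\mathfrak{q}$ be a $\mathrm{Lie}$-central series of $\mathfrak{q}$. Then $\mathfrak{q}^{[i]}\subseteq\mathfrak{m}_{j-i+1}$ for $1\le i\le j+1$. (b) Let $k\ge1$. A Leibniz algebra $\mathfrak{q}$ is $\mathrm{Lie}$-nilpotent with class of $\mathrm{Lie}$-nilpotency $k$ if and only if $\mathfrak{q}^{[k+1]}=0$ and $\mathfrak{q}^{[k]}\ne0$.
   Context: $\mathbb{K}$ is a field with $\frac12\in\mathbb{K}$. A Leibniz algebra is a $\mathbb{K}$-vector space with a bilinear bracket satisfying $[x,[y,z]]=[[x,y],z]-[[x,z],y]$. For two-sided ideals $\mathfrak{m},\mathfrak{n}$ of $\mathfrak{q}$, $[\mathfrak{m},\mathfrak{n}]_{\mathrm{Lie}}$ is the span of all $[m,n]+[n,m]$, $m\in\mathfrak{m}$, $n\in\mathfrak{n}$ (a two-sided ideal of $\mathfrak{q}$). A series of $\mathfrak{q}$ of length $k$ is a finite chain $0=\mathfrak{m}_0\trianglelefteq\mathfrak{m}_1\trianglelefteq\dots\trianglelefteq\mathfrak{m}_k=\mathfrak{q}$ of two-sided ideals $\mathfrak{m}_i$ of $\mathfrak{q}$; it is $\mathrm{Lie}$-central if $[\mathfrak{m}_i,\mathfrak{q}]_{\mathrm{Lie}}\subseteq\mathfrak{m}_{i-1}$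 for $1\le i\le k$. $\mathfrak{q}$ is $\mathrm{Lie}$-nilpotent if it has a $\mathrm{Lie}$-central series; the minimal length of such a series is its class of $\mathrm{Lie}$-nilpotency. The lower $\mathrm{Lie}$-central series is $\mathfrak{q}^{[1]}=\mathfrak{q}$, $\mathfrak{q}^{[i]}=[\mathfrak{q}^{[i-1]},\mathfrak{q}]_{\mathrm{Lie}}$ for $i\ge2$. *)

theory Defs
  imports Complex_Main
begin

text \<open>The carrier of the algebra is the whole type 'q. The Leibniz identity is that of
  right Leibniz algebras: right multiplications are derivations.\<close>

locale leibniz_algebra = vector_space scale
  for scale :: "'k::field \<Rightarrow> 'q::ab_group_add \<Rightarrow> 'q" +
  fixes bracket :: "'q \<Rightarrow> 'q \<Rightarrow> 'q"
  assumes linear_left: "Vector_Spaces.linear scale scale (\<lambda>x. bracket x y)"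
    and linear_right: "Vector_Spaces.linear scale scale (\<lambda>y. bracket x y)"
    and leibniz_identity:
      "bracket x (bracket y z) = bracket (bracket x y) z - bracket (bracket x z) y"
begin

definition two_sided_ideal :: "'q set \<Rightarrow> bool" where
  "two_sided_ideal I \<longleftrightarrow>
     subspace I \<and> (\<forall>x\<in>I. \<forall>y. bracket x y \<in> I \<and> bracket y x \<in> I)"

definition lie_commutator :: "'q set \<Rightarrow> 'q set \<Rightarrow> 'q set" where
  "lie_commutator M N = span {bracket m n + bracket n m | m n. m \<in> M \<and> n \<in> N}"

text \<open>A series of length k is given by the values of m at 0, ..., k; the values beyond k
  are irrelevant. Normality of each term in the next one follows from its being
  an ideal of the whole algebra.\<close>

definition ideal_series :: "(nat \<Rightarrow> 'q set) \<Rightarrow> nat \<Rightarrow> bool" where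
  "ideal_series m k \<longleftrightarrow>
     m 0 = {0} \<and> m k = UNIV \<and>
     (\<forall>i\<le>k. two_sided_ideal (m i)) \<and>
     (\<forall>i<k. m i \<subseteq> m (Suc i))"

definition lie_central_series :: "(nat \<Rightarrow> 'q set) \<Rightarrow> nat \<Rightarrow> bool" where
  "lie_central_series m k \<longleftrightarrow>
     ideal_series m k \<and>
     (\<forall>i\<in>{1..k}. lie_commutator (m i) UNIV \<subseteq> m (i - 1))"

definition lie_nilpotent :: bool where
  "lie_nilpotent \<longleftrightarrow> (\<exists>k m. lie_central_series m k)"

text \<open>Meaningful only if the algebra is Lie-nilpotent.\<close>

definition lie_nilpotency_class :: nat where
  "lie_nilpotency_class = (LEAST k. \<exists>m. lie_central_series m k)"

text \<open>The lower Lie-central series starts at index 1; the value at 0 is a dummy.\<close>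

fun lower_lie_central :: "nat \<Rightarrow> 'q set" where
  "lower_lie_central 0 = UNIV"
| "lower_lie_central (Suc 0) = UNIV"
| "lower_lie_central (Suc (Suc i)) = lie_commutator (lower_lie_central (Suc i)) UNIV"

end

end

theory Submission
  imports Defs
begin

text \<open>Everything rests on one equivalence: a Lie-central series of length k exists if and only if
  the (k+1)-st term of the lower Lie-central series vanishes.

  Every Lie-central series dominates the lower one when both are read downwards from the whole
  algebra: both start there, and if the n-th descending term of the lower series lies in the
  corresponding ideal of the given series, then bracketing both with the whole algebra moves each
  of them one step down (\<open>lower_lie_central_subset_series\<close>). Reading this inclusion at the
  bottom gives the vanishing.

  Conversely, a lower Lie-central series that reaches zero is itself a Lie-central series once its
  terms are listed in the opposite order. The only substantial point is that its terms are
  two-sided ideals (\<open>two_sided_ideal_lie_commutator\<close>). Here the Leibniz identity enters: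
  right multiplications are derivations and therefore preserve the span of the symmetrised
  brackets, and left multiplications annihilate symmetrised brackets.

  Since the lower series is decreasing, the least length of a Lie-central series is k exactly when
  the (k+1)-st term is the first one to vanish.\<close>

context leibniz_algebra
begin

lemmas bracket_add_left = module_hom.add[OF Vector_Spaces.linear.axioms(3), OF linear_left]
lemmas bracket_add_right = module_hom.add[OF Vector_Spaces.linear.axioms(3), OF linear_right]
lemmas bracket_scale_left = module_hom.scale[OF Vector_Spaces.linear.axioms(3), OF linear_left]
lemmas bracket_scale_right = module_hom.scale[OF Vector_Spaces.linear.axioms(3), OF linear_right]
lemmas bracket_zero_left = module_hom.zero[OF Vector_Spaces.linear.axioms(3), OF linear_left]
lemmas bracket_zero_right = module_hom.zero[OF Vector_Spaces.linear.axioms(3), OF linear_right]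

text \<open>Exchanging the two inner factors changes the sign of the right-hand side of the Leibniz
  identity, so symmetrised brackets lie in the right annihilator of the algebra.\<close>

lemma bracket_symmetrised_right: "bracket x (bracket y z + bracket z y) = 0"
  by (simp add: bracket_add_right leibniz_identity)

text \<open>Right multiplication by y, being a derivation of the bracket, is a derivation of the
  symmetrised bracket.\<close>

lemma bracket_symmetrised_left:
  "bracket (bracket m n + bracket n m) y =
     (bracket (bracket m y) n + bracket n (bracket m y)) +
     (bracket m (bracket n y) + bracket (bracket n y) m)"
  by (simp add: bracket_add_left leibniz_identity algebra_simps)

lemma lie_commutator_mono: "M \<subseteq> M' \<Longrightarrow> lie_commutator M N \<subseteq> lie_commutator M' N"
  unfolding lie_commutator_def by (rule span_mono) auto

lemma lie_commutator_generator:
  "m \<in> M \<Longrightarrow> n \<in> N \<Longrightarrow> bracket m n + bracket n m \<in> lie_commutator M N"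
  unfolding lie_commutator_def by (rule span_base) auto

lemma lie_commutator_subset_ideal:
  assumes "two_sided_ideal M"
  shows "lie_commutator M N \<subseteq> M"
proof -
  have sub: "subspace M" using assms by (simp add: two_sided_ideal_def)
  show ?thesis
    unfolding lie_commutator_def
    by (rule span_minimal[OF _ sub])
       (use assms sub in \<open>auto simp: two_sided_ideal_def intro: subspace_add\<close>)
qed

lemma two_sided_ideal_UNIV: "two_sided_ideal UNIV"
  by (simp add: two_sided_ideal_def)

text \<open>By linearity it suffices to multiply a generator \<open>bracket m n + bracket n m\<close>. On the left
  the product is zero; on the right the derivation rule gives two generators, because
  both ideals absorb multiplication.\<close>

lemma two_sided_ideal_lie_commutator:
  assumes M: "two_sided_ideal M" and N: "two_sided_ideal N"
  shows "two_sided_ideal (lie_commutator M N)"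
proof -
  have sub: "subspace (lie_commutator M N)"
    by (simp add: lie_commutator_def)
  have "bracket x y \<in> lie_commutator M N \<and> bracket y x \<in> lie_commutator M N"
    if "x \<in> lie_commutator M N" for x y
    using that[unfolded lie_commutator_def]
  proof (induction rule: span_induct_alt)
    case base
    show ?case
      by (simp add: bracket_zero_left bracket_zero_right subspace_0[OF sub])
  next
    case (step c g x)
    then obtain m n where g: "g = bracket m n + bracket n m" and mn: "m \<in> M" "n \<in> N"
      by blast
    have "bracket m y \<in> M" "bracket n y \<in> N"
      using M N mn by (auto simp: two_sided_ideal_def)
    then have "bracket g y \<in> lie_commutator M N"
      unfolding g bracket_symmetrised_left
      using mn by (intro subspace_add[OF sub] lie_commutator_generator)
    moreover have "bracket y g \<in> lie_commutator M N"
      by (simp add: g bracket_symmetrised_right subspace_0[OF sub])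
    ultimately show ?case
      using step.IH
      by (simp add: bracket_add_left bracket_add_right bracket_scale_left bracket_scale_right
          subspace_add[OF sub] subspace_scale[OF sub])
  qed
  with sub show ?thesis by (simp add: two_sided_ideal_def)
qed

lemma two_sided_ideal_lower_lie_central: "two_sided_ideal (lower_lie_central i)"
  by (induction i rule: lower_lie_central.induct)
     (simp_all add: two_sided_ideal_UNIV two_sided_ideal_lie_commutator)

lemma antimono_lower_lie_central: "antimono lower_lie_central"
  unfolding antimono_iff_le_Suc
proof
  fix i
  show "lower_lie_central (Suc i) \<subseteq> lower_lie_central i"
    by (cases i) (simp_all add: lie_commutator_subset_ideal two_sided_ideal_lower_lie_central)
qed

text \<open>Both sides descend from the whole algebra, and one bracketing with it lowers each of
  them by one step.\<close>

lemma lower_lie_central_subset_series: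
  assumes series: "lie_central_series m j"
  shows "n \<le> j \<Longrightarrow> lower_lie_central (Suc n) \<subseteq> m (j - n)"
proof (induction n)
  case 0
  show ?case using series by (simp add: lie_central_series_def ideal_series_def)
next
  case (Suc n)
  then have "lower_lie_central (Suc (Suc n)) \<subseteq> lie_commutator (m (j - n)) UNIV"
    by (simp add: lie_commutator_mono)
  moreover have "j - n \<in> {1..j}" using Suc.prems by simp
  then have "lie_commutator (m (j - n)) UNIV \<subseteq> m (j - n - 1)"
    using series unfolding lie_central_series_def by blast
  ultimately show ?case by auto
qed

text \<open>The lower Lie-central series listed upwards. The inclusion required of a Lie-central
  series holds with equality, as each term of the lower series is by definition the bracket of
  its predecessor with the whole algebra.\<close>

lemma lie_central_series_reversed_lower:
  assumes "lower_lie_central (Suc k) = {0}"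
  shows "lie_central_series (\<lambda>i. lower_lie_central (Suc k - i)) k"
proof -
  have "lie_commutator (lower_lie_central (Suc k - i)) UNIV
          \<subseteq> lower_lie_central (Suc k - (i - 1))" if "i \<in> {1..k}" for i
  proof -
    have "Suc k - (i - 1) = Suc (Suc (k - i))" "Suc k - i = Suc (k - i)"
      using that by auto
    then show ?thesis by simp
  qed
  moreover have "lower_lie_central (Suc k - i) \<subseteq> lower_lie_central (Suc k - Suc i)" for i
    by (rule antimonoD[OF antimono_lower_lie_central]) simp
  ultimately show ?thesis
    using assms two_sided_ideal_lower_lie_central
    by (simp add: lie_central_series_def ideal_series_def)
qed

lemma ex_lie_central_series_iff:
  "(\<exists>m. lie_central_series m k) \<longleftrightarrow> lower_lie_central (Suc k) = {0}"
proof
  assume "\<exists>m. lie_central_series m k"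
  then obtain m where m: "lie_central_series m k" by blast
  have "lower_lie_central (Suc k) \<subseteq> {0}"
    using lower_lie_central_subset_series[OF m, of k] m
    by (simp add: lie_central_series_def ideal_series_def)
  moreover have "0 \<in> lower_lie_central (Suc k)"
    using two_sided_ideal_lower_lie_central[of "Suc k"] subspace_0
    by (auto simp: two_sided_ideal_def)
  ultimately show "lower_lie_central (Suc k) = {0}" by blast
next
  assume "lower_lie_central (Suc k) = {0}"
  then show "\<exists>m. lie_central_series m k"
    using lie_central_series_reversed_lower by blast
qed

text \<open>The equivalence fails for k = 0 in the trivial algebra: its class is 0, but its first term
  \<open>lower_lie_central 0\<close>, a dummy, is zero as well.\<close>

lemma lie_nilpotency_class_iff:
  assumes "k \<ge> 1"
  shows "lie_nilpotent \<and> lie_nilpotency_class = k \<longleftrightarrow>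
           lower_lie_central (k + 1) = {0} \<and> lower_lie_central k \<noteq> {0}"
proof
  assume *: "lie_nilpotent \<and> lie_nilpotency_class = k"
  then obtain l where l: "lower_lie_central (Suc l) = {0}"
    unfolding lie_nilpotent_def ex_lie_central_series_iff by blast
  from * have k: "(LEAST k. lower_lie_central (Suc k) = {0}) = k"
    by (simp add: lie_nilpotency_class_def ex_lie_central_series_iff)
  have "lower_lie_central (Suc k) = {0}"
    using LeastI[of "\<lambda>k. lower_lie_central (Suc k) = {0}", OF l] unfolding k .
  moreover have "lower_lie_central k \<noteq> {0}"
    using not_less_Least[of "k - 1" "\<lambda>k. lower_lie_central (Suc k) = {0}"] assms
    unfolding k by simp
  ultimately show "lower_lie_central (k + 1) = {0} \<and> lower_lie_central k \<noteq> {0}" by simp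
next
  assume *: "lower_lie_central (k + 1) = {0} \<and> lower_lie_central k \<noteq> {0}"
  have least: "k \<le> l" if "lower_lie_central (Suc l) = {0}" for l
  proof (rule ccontr)
    \<comment> \<open>A zero term before index k would force the k-th term to be contained in zero, while
      every term contains zero.\<close>
    assume "\<not> k \<le> l"
    then have "lower_lie_central k \<subseteq> lower_lie_central (Suc l)"
      by (intro antimonoD[OF antimono_lower_lie_central]) simp
    moreover have "0 \<in> lower_lie_central k"
      using two_sided_ideal_lower_lie_central[of k] subspace_0
      by (auto simp: two_sided_ideal_def)
    ultimately show False using that * by blast
  qed
  have "(LEAST k. lower_lie_central (Suc k) = {0}) = k"
    using * least by (intro Least_equality) auto
  then have "lie_nilpotency_class = k"
    by (simp add: lie_nilpotency_class_def ex_lie_central_series_iff)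
  moreover have lie_nilpotent
    using * unfolding lie_nilpotent_def ex_lie_central_series_iff by auto
  ultimately show "lie_nilpotent \<and> lie_nilpotency_class = k" by simp
qed

end

theorem theorem5p9:
  fixes scale :: "'k::field \<Rightarrow> 'q::ab_group_add \<Rightarrow> 'q"
    and bracket :: "'q \<Rightarrow> 'q \<Rightarrow> 'q"
  assumes "(2::'k) \<noteq> 0"
    and "leibniz_algebra scale bracket"
  shows "(\<forall>j m. leibniz_algebra.lie_central_series scale bracket m j \<longrightarrow>
            (\<forall>i. 1 \<le> i \<and> i \<le> j + 1 \<longrightarrow>
               leibniz_algebra.lower_lie_central scale bracket i \<subseteq> m (j + 1 - i)))
       \<and> (\<forall>k\<ge>1.
            leibniz_algebra.lie_nilpotent scale bracket \<and>
            leibniz_algebra.lie_nilpotency_class scale bracket = k \<longleftrightarrow>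
            leibniz_algebra.lower_lie_central scale bracket (k + 1) = {0} \<and>
            leibniz_algebra.lower_lie_central scale bracket k \<noteq> {0})"
proof -
  interpret leibniz_algebra scale bracket by fact
  have "lower_lie_central i \<subseteq> m (j + 1 - i)"
    if "lie_central_series m j" "1 \<le> i \<and> i \<le> j + 1" for j m i
    using lower_lie_central_subset_series[OF that(1), of "i - 1"] that(2)
    by (cases i) simp_all
  then show ?thesis
    using lie_nilpotency_class_iff by blast
qed

end
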